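(* Let $K$ be a field of characteristic zero and let $L$ be a finite dimensional Lie algebra over $K$. Suppose there exist an abelian Lie subalgebra $D \leq \mathrm{Der}(L)$ and an integer $n > 1$ such that $$L^n \subseteq \sum_{d \in D} d(L).$$ Then $L$ is solvable.
   Context: $\mathrm{Der}(L)$ denotes the Lie algebra of all $K$-linear derivations of $L$, with the commutator bracket. $L^n$ denotes the $n$-th term of the lower central series of $L$, indexed by $L^1 = L$ and $L^{k+1} = [L, L^k]$ (so $L^2 = [L,L]$). $\sum_{d \in D} d(L)$ is the sum of the linear subspaces $d(L) \subseteq L$, i.e. the set of all finite sums $\sum_i d_i(u_i)$ with $d_i \in D$, $u_i \in L$. *)

theory Defs
  imports Complex_Main "HOL-Library.Function_Algebras"
begin

locale lie_algebra = vector_space scale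
  for scale :: "'k::field \<Rightarrow> 'a::ab_group_add \<Rightarrow> 'a" +
  fixes br :: "'a \<Rightarrow> 'a \<Rightarrow> 'a"
  assumes br_add_left: "br (x + y) z = br x z + br y z"
    and br_add_right: "br x (y + z) = br x y + br x z"
    and br_scale_left: "br (scale c x) y = scale c (br x y)"
    and br_scale_right: "br x (scale c y) = scale c (br x y)"
    and br_self: "br x x = 0"
    and jacobi: "br x (br y z) + br y (br z x) + br z (br x y) = 0"

(* The next two notions take the operations as parameters because they are used
   for Der(L), whose operations live on the function type 'a => 'a. *)

definition lie_subalgebra ::
  "('k::field \<Rightarrow> 'a::ab_group_add \<Rightarrow> 'a) \<Rightarrow> ('a \<Rightarrow> 'a \<Rightarrow> 'a) \<Rightarrow> 'a set \<Rightarrow> bool" where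
  "lie_subalgebra scale br S \<longleftrightarrow>
     module.subspace scale S \<and> (\<forall>x\<in>S. \<forall>y\<in>S. br x y \<in> S)"

definition lie_abelian :: "('a::zero \<Rightarrow> 'a \<Rightarrow> 'a) \<Rightarrow> 'a set \<Rightarrow> bool" where
  "lie_abelian br S \<longleftrightarrow> (\<forall>x\<in>S. \<forall>y\<in>S. br x y = 0)"

definition bracket_span ::
  "('k::field \<Rightarrow> 'a::ab_group_add \<Rightarrow> 'a) \<Rightarrow> ('a \<Rightarrow> 'a \<Rightarrow> 'a) \<Rightarrow> 'a set \<Rightarrow> 'a set \<Rightarrow> 'a set" where
  "bracket_span scale br A B = module.span scale {br a b | a b. a \<in> A \<and> b \<in> B}"

(* Indexed from 1; the value at 0 is a dummy. *)
fun lower_central ::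
  "('k::field \<Rightarrow> 'a::ab_group_add \<Rightarrow> 'a) \<Rightarrow> ('a \<Rightarrow> 'a \<Rightarrow> 'a) \<Rightarrow> nat \<Rightarrow> 'a set" where
  "lower_central scale br 0 = UNIV"
| "lower_central scale br (Suc 0) = UNIV"
| "lower_central scale br (Suc (Suc k)) =
     bracket_span scale br UNIV (lower_central scale br (Suc k))"

primrec derived_series ::
  "('k::field \<Rightarrow> 'a::ab_group_add \<Rightarrow> 'a) \<Rightarrow> ('a \<Rightarrow> 'a \<Rightarrow> 'a) \<Rightarrow> nat \<Rightarrow> 'a set" where
  "derived_series scale br 0 = UNIV"
| "derived_series scale br (Suc k) =
     bracket_span scale br (derived_series scale br k) (derived_series scale br k)"

definition lie_solvable ::
  "('k::field \<Rightarrow> 'a::ab_group_add \<Rightarrow> 'a) \<Rightarrow> ('a \<Rightarrow> 'a \<Rightarrow> 'a) \<Rightarrow> bool" where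
  "lie_solvable scale br \<longleftrightarrow> (\<exists>k. derived_series scale br k = {0})"

definition derivations ::
  "('k::field \<Rightarrow> 'a::ab_group_add \<Rightarrow> 'a) \<Rightarrow> ('a \<Rightarrow> 'a \<Rightarrow> 'a) \<Rightarrow> ('a \<Rightarrow> 'a) set" where
  "derivations scale br =
     {d. Vector_Spaces.linear scale scale d \<and> (\<forall>x y. d (br x y) = br (d x) y + br x (d y))}"

definition fun_scale :: "('k \<Rightarrow> 'a \<Rightarrow> 'a) \<Rightarrow> 'k \<Rightarrow> ('a \<Rightarrow> 'a) \<Rightarrow> 'a \<Rightarrow> 'a" where
  "fun_scale scale c f = (\<lambda>x. scale c (f x))"

definition commutator :: "('a::ab_group_add \<Rightarrow> 'a) \<Rightarrow> ('a \<Rightarrow> 'a) \<Rightarrow> 'a \<Rightarrow> 'a" where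
  "commutator d e = (\<lambda>x. d (e x) - e (d x))"

definition sum_of_images :: "('a \<Rightarrow> 'a::ab_group_add) set \<Rightarrow> 'a set" where
  "sum_of_images D = {\<Sum>i<m. d i (u i) | (m::nat) d u. \<forall>i<m. d i \<in> D}"

context lie_algebra
begin

lemma module_fun_scale: "module (fun_scale scale)"
  by unfold_locales
    (simp_all add: fun_scale_def fun_eq_iff scale_right_distrib scale_left_distrib)

lemma linear_iff_hom:
  "Vector_Spaces.linear scale scale d \<longleftrightarrow>
     (\<forall>x y. d (x + y) = d x + d y) \<and> (\<forall>c x. d (scale c x) = scale c (d x))"
  using vector_space_axioms by (auto simp: Vector_Spaces.linear_iff)

lemma lie_subalgebra_derivations:
  "lie_subalgebra (fun_scale scale) commutator (derivations scale br)"
proof -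
  have z: "br 0 y = 0" "br y 0 = 0" for y
    using br_scale_left[of 0 0 y] br_scale_right[of y 0 0] by simp_all
  have diff: "br (x - y) w = br x w - br y w" "br w (x - y) = br w x - br w y" for x y w
    using br_add_left[of "x - y" y w] br_add_right[of w "x - y" y] by (simp_all add: algebra_simps)
  show ?thesis
    unfolding lie_subalgebra_def module.subspace_def[OF module_fun_scale]
    by (auto simp: derivations_def linear_iff_hom fun_scale_def commutator_def z diff
        br_add_left br_add_right br_scale_left br_scale_right algebra_simps)
qed

lemma sum_of_images_eq_span:
  assumes "lie_subalgebra (fun_scale scale) commutator D"
    and "D \<subseteq> derivations scale br"
  shows "sum_of_images D = span (\<Union>d\<in>D. range d)"
proof
  show "sum_of_images D \<subseteq> span (\<Union>d\<in>D. range d)"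
  proof
    fix x assume "x \<in> sum_of_images D"
    then obtain m d u where m: "x = (\<Sum>i<(m::nat). d i (u i))" "\<forall>i<m. d i \<in> D"
      unfolding sum_of_images_def by auto
    have "d i (u i) \<in> span (\<Union>d\<in>D. range d)" if "i < m" for i
      using that m(2) by (intro span_base) auto
    then show "x \<in> span (\<Union>d\<in>D. range d)"
      unfolding m(1) by (intro span_sum) auto
  qed
next
  have lin: "d (scale c x) = scale c (d x)" if "d \<in> D" for d c x
    using that assms(2) by (auto simp: derivations_def linear_iff_hom)
  show "span (\<Union>d\<in>D. range d) \<subseteq> sum_of_images D"
  proof
    fix x assume "x \<in> span (\<Union>d\<in>D. range d)"
    then show "x \<in> sum_of_images D"
    proof (induction rule: span_induct_alt)
      case base
      show ?case unfolding sum_of_images_def by (auto intro!: exI[of _ "0::nat"])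
    next
      case (step c y z)
      obtain e w where e: "e \<in> D" "y = e w" using step by auto
      obtain m d u where m: "z = (\<Sum>i<(m::nat). d i (u i))" "\<forall>i<m. d i \<in> D"
        using step unfolding sum_of_images_def by auto
      have "scale c y + z =
          (\<Sum>i<Suc m. (d(m := e)) i ((u(m := scale c w)) i))"
        by (simp add: m e lin)
      moreover have "\<forall>i<Suc m. (d(m := e)) i \<in> D"
        using m e by auto
      ultimately show ?case unfolding sum_of_images_def by blast
    qed
  qed
qed

end

end

theory Submission
  imports Defs "HOL-Algebra.Algebraic_Closure_Type" "Jordan_Normal_Form.Jordan_Normal_Form_Existence"
begin

text \<open>Let \<open>\<kappa>\<close> be the Killing form of \<open>L\<close>. As the elements of \<open>D\<close> commute,
  \<open>tr (d \<circ> ad (e u)) = tr ([d, e] \<circ> ad u) = 0\<close> for \<open>d, e \<in> D\<close>, so \<open>tr (d \<circ> ad y) = 0\<close> for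
  every \<open>y\<close> in the ideal \<open>L\<^sup>n\<close>. Hence \<open>\<kappa> (d z) y = tr (d \<circ> ad [z, y]) = 0\<close> for such \<open>y\<close> and all \<open>z\<close>,
  and therefore \<open>\<kappa>\<close> vanishes on \<open>L\<^sup>n\<close>. The derived series stabilizes at a perfect subalgebra
  \<open>P \<subseteq> L\<^sup>n\<close>. The argument for Cartan's criterion, carried out with matrices over the algebraic closure,
  shows that every \<open>ad x\<close> with \<open>x \<in> P\<close> is nilpotent, so \<open>P = [P, P]\<close> is zero by Engel's theorem.\<close>

subsection \<open>Block triangular form over an algebraically closed field\<close>

text \<open>Since \<open>v $ k\<close> is nonzero, \<open>v\<close> together with all unit vectors
  except the one of index \<open>k\<close> is a basis. The transposition of 0 and \<open>k\<close>
  lists these unit vectors in the columns after the first.\<close>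

lemma exists_invertible_with_first_col:
  fixes v :: "'f::field vec"
  assumes v: "v \<in> carrier_vec n" and v0: "v \<noteq> 0\<^sub>v n"
  obtains W W' where "W \<in> carrier_mat n n" "W' \<in> carrier_mat n n"
    "W * W' = 1\<^sub>m n" "W' * W = 1\<^sub>m n" "col W 0 = v"
proof -
  obtain k where k: "k < n" "v $ k \<noteq> 0"
    using v v0 by (metis carrier_vecD eq_vecI index_zero_vec(1) index_zero_vec(2))
  let ?s = "Transposition.transpose 0 k"
  define W where "W = mat n n (\<lambda>(i,j). if j = 0 then v $ i else if i = ?s j then 1 else 0)"
  have W: "W \<in> carrier_mat n n" unfolding W_def by simp
  have "det W \<noteq> 0"
  proof
    assume "det W = 0"
    then obtain x where x: "x \<in> carrier_vec n" "x \<noteq> 0\<^sub>v n" and Wx: "W *\<^sub>v x = 0\<^sub>v n"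
      using det_0_iff_vec_prod_zero[OF W] by auto
    have row: "(\<Sum>j<n. W $$ (i,j) * x $ j) = 0" if "i < n" for i
    proof -
      have "(W *\<^sub>v x) $ i = 0" using Wx that by simp
      then show ?thesis using W x that
        by (simp add: scalar_prod_def row_def atLeast0LessThan)
    qed
    \<comment> \<open>Row \<open>k\<close> of \<open>W\<close> vanishes outside column 0, because
      \<open>?s j = k\<close> only for \<open>j = 0\<close>.\<close>
    have "(\<Sum>j<n. W $$ (k,j) * x $ j) = (\<Sum>j<n. if j = 0 then v $ k * x $ 0 else 0)"
      using k by (intro sum.cong) (auto simp: W_def Transposition.transpose_def split: if_splits)
    then have x0: "x $ 0 = 0" using row[OF k(1)] k by (simp split: if_splits)
    have "x $ j = 0" if j: "j < n" for j
    proof (cases "j = 0")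
      case False
      have sj: "?s j < n" using j k by (auto simp: Transposition.transpose_def)
      have inj: "?s j = ?s l \<longleftrightarrow> l = j" for l by (metis transpose_involutory)
      have "(\<Sum>l<n. W $$ (?s j,l) * x $ l) = (\<Sum>l<n. if l = j then x $ j else 0)"
        using sj x0 False by (intro sum.cong) (auto simp: W_def inj)
      then show ?thesis using row[OF sj] j by simp
    qed (use x0 in simp)
    then show False using x by (metis carrier_vecD eq_vecI index_zero_vec(1) index_zero_vec(2))
  qed
  then obtain W' where "W' \<in> carrier_mat n n" "W * W' = 1\<^sub>m n" "W' * W = 1\<^sub>m n"
    using det_non_zero_imp_unit[OF W, of "()"] by (auto simp: Units_def ring_mat_def)
  moreover have "col W 0 = v" using v k by (intro eq_vecI) (auto simp: W_def)
  ultimately show ?thesis using that W by blast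
qed

text \<open>Induction on the size: an eigenvector taken as first basis vector splits off a 1 by 1
  block, and the induction hypothesis triangularizes the remaining diagonal block.\<close>

lemma triangularizable:
  fixes A :: "'f::alg_closed_field mat"
  assumes "A \<in> carrier_mat n n"
  shows "\<exists>B \<in> carrier_mat n n. upper_triangular B \<and> similar_mat A B"
  using assms
proof (induction n arbitrary: A)
  case 0
  then show ?case by (intro bexI[of _ A]) (auto intro!: similar_mat_refl)
next
  case (Suc n A)
  have "degree (char_poly A) > 0" using degree_monic_char_poly[OF Suc.prems] by simp
  then obtain e where "poly (char_poly A) e = 0" using alg_closed_imp_poly_has_root by blast
  then obtain v where v: "v \<in> carrier_vec (Suc n)" "v \<noteq> 0\<^sub>v (Suc n)" "A *\<^sub>v v = e \<cdot>\<^sub>v v"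
    using eigenvalue_root_char_poly[OF Suc.prems, of e] Suc.prems
    unfolding eigenvalue_def eigenvector_def by auto
  obtain W W' where W: "W \<in> carrier_mat (Suc n) (Suc n)" "W' \<in> carrier_mat (Suc n) (Suc n)"
    "W * W' = 1\<^sub>m (Suc n)" "W' * W = 1\<^sub>m (Suc n)" "col W 0 = v"
    using exists_invertible_with_first_col[OF v(1,2)] .
  define A' where "A' = W' * A * W"
  have A': "A' \<in> carrier_mat (Suc n) (Suc n)" using W Suc.prems unfolding A'_def by simp
  have "similar_mat_wit A' A W' W"
    using W Suc.prems A' by (intro similar_mat_witI[of _ _ "Suc n"]) (auto simp: A'_def)
  then have sim: "similar_mat A A'" using similar_mat_sym unfolding similar_mat_def by blast
  have "col A' 0 = W' *\<^sub>v (A *\<^sub>v v)"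
    using W Suc.prems v unfolding A'_def
    by (subst col_mult2[of _ "Suc n" "Suc n" _ "Suc n"]) auto
  also have "\<dots> = e \<cdot>\<^sub>v (W' *\<^sub>v col W 0)" using W v by (simp add: mult_mat_vec)
  also have "W' *\<^sub>v col W 0 = col (W' * W) 0" using W by (subst col_mult2[of _ "Suc n" "Suc n" _ "Suc n"]) auto
  also have "\<dots> = unit_vec (Suc n) 0" using W(4) by simp
  finally have col0: "col A' 0 = e \<cdot>\<^sub>v unit_vec (Suc n) 0" .
  obtain A1 A2 A0 A3 where sp: "split_block A' 1 1 = (A1,A2,A0,A3)"
    by (cases "split_block A' 1 1") auto
  have "dim_row A' = 1 + n" "dim_col A' = 1 + n" using A' by auto
  note sb = split_block[OF sp this]
  have A0: "A0 = 0\<^sub>m n 1"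
  proof (rule eq_matI)
    fix i j assume ij: "i < dim_row (0\<^sub>m n 1 :: 'f mat)" "j < dim_col (0\<^sub>m n 1 :: 'f mat)"
    have "A' $$ (Suc i, 0) = col A' 0 $ Suc i" using ij A' by simp
    also have "\<dots> = 0" using ij unfolding col0 by simp
    finally show "A0 $$ (i,j) = 0\<^sub>m n 1 $$ (i,j)"
      using sb ij by simp
  qed (use sb in auto)
  obtain B where B: "B \<in> carrier_mat n n" "upper_triangular B" "similar_mat A3 B"
    using Suc.IH[OF sb(4)] by auto
  obtain B0 where B0: "B0 \<in> carrier_mat 1 n"
    "similar_mat (four_block_mat A1 A2 (0\<^sub>m n 1) A3) (four_block_mat A1 B0 (0\<^sub>m n 1) B)"
    using similar_mat_four_block_0_ex[OF similar_mat_refl[OF sb(1)] B(3) sb(2) sb(1) sb(4)] by auto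
  have "upper_triangular A1" using sb(1) by (intro upper_triangularI) auto
  then have "upper_triangular (four_block_mat A1 B0 (0\<^sub>m n 1) B)"
    using upper_triangular_four_block[OF sb(1) B(1) _ B(2)] by simp
  moreover have "four_block_mat A1 B0 (0\<^sub>m n 1) B \<in> carrier_mat (Suc n) (Suc n)"
    using four_block_carrier_mat[OF sb(1) B(1), of B0 "0\<^sub>m n 1"] by simp
  ultimately show ?case
    using similar_mat_trans[OF sim] B0(2) sb(5) A0 by (metis)
qed

text \<open>A nonzero entry lies within a single Jordan block, on or just above its constant
  diagonal.\<close>

lemma jordan_matrix_index_nonzero:
  assumes "i < sum_list (map fst n_as)" "j < sum_list (map fst n_as)"
    and "jordan_matrix n_as $$ (i,j) \<noteq> 0"
  shows "i \<le> j \<and> jordan_matrix n_as $$ (i,i) = jordan_matrix n_as $$ (j,j)"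
  using assms
proof (induction n_as arbitrary: i j)
  case (Cons na n_as)
  obtain n a where na: "na = (n,a)" by force
  let ?s = "sum_list (map fst n_as)"
  have *: "jordan_matrix (na # n_as) $$ (i,j) =
    (if i < n then (if j < n then jordan_block n a $$ (i,j) else 0)
     else if j < n then 0 else jordan_matrix n_as $$ (i - n, j - n))"
    if "i < n + ?s" "j < n + ?s" for i j
    using that unfolding na jordan_matrix_Cons by simp
  have ij: "i < n + ?s" "j < n + ?s" using Cons.prems na by auto
  show ?case
  proof (cases "i < n")
    case True
    then show ?thesis using Cons.prems(3) unfolding *[OF ij] *[OF ij(1,1)] *[OF ij(2,2)]
      by (auto split: if_splits)
  next
    case False
    moreover have j: "\<not> j < n" using False Cons.prems(3) unfolding *[OF ij] by auto
    moreover have "i - n \<le> j - n \<and> jordan_matrix n_as $$ (i - n, i - n) = jordan_matrix n_as $$ (j - n, j - n)"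
      using Cons.prems(3) Cons.IH[of "i - n" "j - n"] ij False j unfolding *[OF ij] by auto
    ultimately show ?thesis
      unfolding *[OF ij(1,1)] *[OF ij(2,2)] by auto
  qed
qed simp

text \<open>The condition on \<open>J\<close> makes its diagonal part commute with its strictly
  upper triangular part, which is a matrix form of the Jordan-Chevalley decomposition. The Jordan
  normal form has this property.\<close>

lemma similar_block_triangular:
  fixes A :: "'f::alg_closed_field mat"
  assumes A: "A \<in> carrier_mat n n"
  obtains J P Q where "similar_mat_wit A J P Q"
    "\<And>i j. i < n \<Longrightarrow> j < n \<Longrightarrow> J $$ (i,j) \<noteq> 0 \<Longrightarrow> i \<le> j \<and> J $$ (i,i) = J $$ (j,j)"
proof -
  obtain B where B: "B \<in> carrier_mat n n" "upper_triangular B" "similar_mat A B"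
    using triangularizable[OF A] by auto
  have "similar_mat B (jordan_matrix (triangular_to_jnf_vector B))"
    using triangular_to_jnf_vector[OF B(1,2)] unfolding jordan_nf_def by auto
  then obtain P Q where w: "similar_mat_wit A (jordan_matrix (triangular_to_jnf_vector B)) P Q"
    using similar_mat_trans[OF B(3)] unfolding similar_mat_def by blast
  have "sum_list (map fst (triangular_to_jnf_vector B)) = n"
    using similar_mat_witD2(5)[OF A w] by auto
  then show ?thesis using that[OF w] jordan_matrix_index_nonzero by blast
qed

subsection \<open>Subspaces invariant under \<open>ad J\<close>\<close>

definition shift_op :: "('k \<Rightarrow> 'v \<Rightarrow> 'v) \<Rightarrow> ('v \<Rightarrow> 'v::ab_group_add) \<Rightarrow> 'k \<Rightarrow> 'v \<Rightarrow> 'v" where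
  "shift_op scale T c v = T v - scale c v"

lemma funpow_swap_commute:
  assumes "\<And>x. f (g x) = g (f x)"
  shows "(f ^^ i) ((g ^^ j) x) = (g ^^ j) ((f ^^ i) x)"
proof -
  have *: "f ((g ^^ j) x) = (g ^^ j) (f x)" for x
    by (induction j) (simp_all add: assms)
  show ?thesis by (induction i) (simp_all add: *)
qed

context vector_space
begin

context
  fixes T :: "'b \<Rightarrow> 'b" and W :: "'b set"
  assumes T: "Vector_Spaces.linear scale scale T"
    and W: "subspace W" and TW: "\<And>v. v \<in> W \<Longrightarrow> T v \<in> W"
begin

interpretation T: Vector_Spaces.linear scale scale T by (rule T)

lemma shift_op_commute:
  "shift_op scale T a (shift_op scale T b v) = shift_op scale T b (shift_op scale T a v)"
  by (simp add: shift_op_def T.diff T.scale scale_right_diff_distrib mult.commute algebra_simps)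

lemma shift_op_mem: "v \<in> W \<Longrightarrow> shift_op scale T c v \<in> W"
  unfolding shift_op_def by (intro subspace_diff subspace_scale W TW)

lemma shift_op_funpow_mem: "v \<in> W \<Longrightarrow> (shift_op scale T c ^^ j) v \<in> W"
  by (induction j) (auto intro: shift_op_mem)

lemma shift_op_funpow_sum:
  "(shift_op scale T c ^^ j) (\<Sum>i\<in>I. f i) = (\<Sum>i\<in>I. (shift_op scale T c ^^ j) (f i))"
  by (induction j) (simp_all add: shift_op_def T.sum scale_sum_right sum_subtractf)

lemma shift_op_funpow_0: "(shift_op scale T c ^^ j) 0 = 0"
  by (induction j) (simp_all add: shift_op_def T.zero)

text \<open>On the generalized eigenspace for \<open>a\<close> the operator \<open>T - c\<close> is
  invertible, so membership in \<open>W\<close> can be pulled back along it. By induction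
  \<open>(T - a) v\<close> lies in \<open>W\<close>, and subtracting \<open>(T - c) v\<close> leaves
  a nonzero multiple of \<open>v\<close>.\<close>

lemma mem_of_shift_op_mem:
  assumes "a \<noteq> c" "(shift_op scale T a ^^ j) v = 0" "shift_op scale T c v \<in> W"
  shows "v \<in> W"
  using assms(2,3)
proof (induction j arbitrary: v)
  case 0
  then show ?case using subspace_0[OF W] by simp
next
  case (Suc j)
  have 1: "shift_op scale T a v \<in> W"
  proof (rule Suc.IH)
    show "(shift_op scale T a ^^ j) (shift_op scale T a v) = 0"
      using Suc.prems(1) by (simp add: funpow_swap1)
    show "shift_op scale T c (shift_op scale T a v) \<in> W"
      using shift_op_mem[OF Suc.prems(2)] by (simp add: shift_op_commute)
  qed
  have "shift_op scale T a v - shift_op scale T c v = scale (c - a) v"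
    by (simp add: shift_op_def scale_left_diff_distrib)
  then have "scale (c - a) v \<in> W" using subspace_diff[OF W 1 Suc.prems(2)] by simp
  then have "scale (inverse (c - a)) (scale (c - a) v) \<in> W" by (rule subspace_scale[OF W])
  then show ?case using assms(1) by simp
qed

text \<open>Induction on the number of eigenvalues: the \<open>k\<close>-th power of
  \<open>T - c\<close> kills the component for \<open>c\<close>, so by the induction hypothesis it
  sends every other component into \<open>W\<close>. Its factors are then removed one at a time, and
  the component for \<open>c\<close> is what remains of the sum.\<close>

lemma generalized_eigencomponents_mem:
  assumes "finite M"
    and "\<And>a. a \<in> M \<Longrightarrow> (shift_op scale T a ^^ k) (v a) = 0"
    and "(\<Sum>a\<in>M. v a) \<in> W"
    and "a \<in> M"
  shows "v a \<in> W"
  using assms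
proof (induction M arbitrary: v a rule: finite_induct)
  case (insert c M)
  let ?S = "shift_op scale T c ^^ k"
  have "?S (\<Sum>a\<in>insert c M. v a) = (\<Sum>a\<in>M. ?S (v a))"
    unfolding shift_op_funpow_sum using insert.hyps insert.prems(1)[of c] by simp
  then have sum: "(\<Sum>a\<in>M. ?S (v a)) \<in> W"
    using shift_op_funpow_mem[OF insert.prems(2)] by metis
  have ann: "(shift_op scale T a ^^ k) ((shift_op scale T c ^^ j) (v a)) = 0" if "a \<in> M" for a j
    using insert.prems(1)[of a] that by (simp add: shift_op_funpow_0 funpow_swap_commute[where f = "shift_op scale T a" and g = "shift_op scale T c",
        OF shift_op_commute])
  have S: "?S (v a) \<in> W" if "a \<in> M" for a
    using insert.IH[of "\<lambda>a. ?S (v a)" a] ann sum that by blast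
  have M: "v a \<in> W" if a: "a \<in> M" for a
  proof -
    have "a \<noteq> c" using a insert.hyps by auto
    have "(shift_op scale T c ^^ j) (v a) \<in> W \<Longrightarrow> v a \<in> W" for j
    proof (induction j)
      case (Suc j)
      then show ?case using mem_of_shift_op_mem[OF \<open>a \<noteq> c\<close> ann[OF a, of j]] by simp
    qed simp
    then show ?thesis using S[OF a] by blast
  qed
  have "(\<Sum>a\<in>insert c M. v a) - (\<Sum>a\<in>M. v a) \<in> W"
    by (intro subspace_diff[OF W] insert.prems(2) subspace_sum[OF W] M)
  then have "v c \<in> W" using insert.hyps by simp
  then show ?case using M insert.prems(3) by auto
qed simp

end

end

text \<open>Functions on all index pairs form a vector space as a type; matrices of size
  \<open>m\<close> become the functions supported on indices below \<open>m\<close>.\<close>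

definition mat_scale :: "'f::field \<Rightarrow> (nat \<Rightarrow> nat \<Rightarrow> 'f) \<Rightarrow> nat \<Rightarrow> nat \<Rightarrow> 'f" where
  "mat_scale c w = (\<lambda>i j. c * w i j)"

interpretation mat_vs: vector_space mat_scale
  by unfold_locales (auto simp: mat_scale_def fun_eq_iff algebra_simps)

text \<open>The operator in the conclusion acts by the scalar \<open>\<psi> a\<close> on the generalized eigenspace of \<open>ad J\<close>
  for the eigenvalue \<open>a\<close>, which consists of the matrices supported where \<open>J i i - J j j = a\<close>.\<close>

lemma block_triangular_ad_invariant:
  fixes J :: "nat \<Rightarrow> nat \<Rightarrow> 'f::field"
  assumes J: "\<And>i j. J i j \<noteq> 0 \<Longrightarrow> i < m \<and> j < m \<and> i \<le> j \<and> J i i = J j j"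
    and W: "mat_vs.subspace W"
    and supp: "\<And>w i j. w \<in> W \<Longrightarrow> w i j \<noteq> 0 \<Longrightarrow> i < m \<and> j < m"
    and inv: "\<And>w. w \<in> W \<Longrightarrow> (\<lambda>i j. (\<Sum>k<m. J i k * w k j) - (\<Sum>k<m. w i k * J k j)) \<in> W"
    and w: "w \<in> W"
  shows "(\<lambda>i j. \<psi> (J i i - J j j) * w i j) \<in> W"
proof -
  define T where "T w = (\<lambda>i j. (\<Sum>k<m. J i k * w k j) - (\<Sum>k<m. w i k * J k j))"
    for w :: "nat \<Rightarrow> nat \<Rightarrow> 'f"
  have T: "Vector_Spaces.linear mat_scale mat_scale T"
    unfolding Vector_Spaces.linear_iff
    using mat_vs.vector_space_axioms
    by (auto simp: T_def mat_scale_def fun_eq_iff algebra_simps sum.distrib sum_distrib_left)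
  \<comment> \<open>\<open>M\<close> holds the eigenvalues of \<open>ad J\<close> on
    \<open>m\<close> by \<open>m\<close> matrices, and \<open>v a\<close> below is the component of
    \<open>w\<close> for the eigenvalue \<open>a\<close>.\<close>
  define M where "M = (\<lambda>(i,j). J i i - J j j) ` ({..<m} \<times> {..<m})"
  have fM: "finite M" unfolding M_def by simp
  define v where "v a = (\<lambda>i j. if J i i - J j j = a then w i j else 0)" for a
  \<comment> \<open>Each application of \<open>ad J - a\<close> moves the support at least one
    diagonal upwards. The bound is \<open>j - i \<ge> n - m\<close> without subtraction, so
    \<open>2 * m\<close> applications leave nothing.\<close>
  have pow: "((shift_op mat_scale T a ^^ n) (v a)) i j \<noteq> 0 \<Longrightarrow>
      i < m \<and> j < m \<and> J i i - J j j = a \<and> i + n \<le> j + m" for a n i j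
  proof (induction n arbitrary: i j)
    case 0
    then show ?case using supp[OF w, of i j] by (auto simp: v_def split: if_splits)
  next
    case (Suc n)
    define u where "u = (shift_op mat_scale T a ^^ n) (v a)"
    have u: "u i j \<noteq> 0 \<Longrightarrow> i < m \<and> j < m \<and> J i i - J j j = a \<and> i + n \<le> j + m" for i j
      using Suc.IH unfolding u_def .
    have nz: "(\<Sum>k<m. J i k * u k j) - (\<Sum>k<m. u i k * J k j) - a * u i j \<noteq> 0"
    proof -
      have eq: "(shift_op mat_scale T a ^^ Suc n) (v a) = shift_op mat_scale T a u"
        by (simp add: u_def)
      show ?thesis using Suc.prems[unfolded eq] by (simp add: shift_op_def T_def mat_scale_def)
    qed
    have ij: "i < m \<and> j < m"
    proof (rule ccontr)
      assume n: "\<not> (i < m \<and> j < m)"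
      have "(\<Sum>k<m. J i k * u k j) = 0" using n J u by (intro sum.neutral) (metis mult_eq_0_iff)
      moreover have "(\<Sum>k<m. u i k * J k j) = 0" using n J u by (intro sum.neutral) (metis mult_eq_0_iff)
      moreover have "u i j = 0" using n u by blast
      ultimately show False using nz by simp
    qed
    \<comment> \<open>Only the terms \<open>k = i\<close> and \<open>k = j\<close> involve the
      diagonal of \<open>J\<close>; together with \<open>- a\<close> they cancel on the support of
      \<open>u\<close>. What remains uses strictly upper entries of \<open>J\<close>.\<close>
    have "(\<Sum>k<m. J i k * u k j) - (\<Sum>k<m. u i k * J k j) - a * u i j =
      (\<Sum>k\<in>{..<m}-{i}. J i k * u k j) - (\<Sum>k\<in>{..<m}-{j}. u i k * J k j) + (J i i - J j j - a) * u i j"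
      using ij sum.remove[of "{..<m}" i "\<lambda>k. J i k * u k j"] sum.remove[of "{..<m}" j "\<lambda>k. u i k * J k j"]
      by (simp add: algebra_simps)
    also have "(J i i - J j j - a) * u i j = 0" using u by auto
    finally have "(\<Sum>k\<in>{..<m}-{i}. J i k * u k j) \<noteq> 0 \<or> (\<Sum>k\<in>{..<m}-{j}. u i k * J k j) \<noteq> 0"
      using nz by auto
    then consider "(\<Sum>k\<in>{..<m}-{i}. J i k * u k j) \<noteq> 0" | "(\<Sum>k\<in>{..<m}-{j}. u i k * J k j) \<noteq> 0"
      by blast
    then show ?case
    proof cases
      case 1
      then obtain k where k: "k \<noteq> i" "J i k \<noteq> 0" "u k j \<noteq> 0"
        by (rule sum.not_neutral_contains_not_neutral) auto
      then show ?thesis using J[OF k(2)] u[OF k(3)] by auto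
    next
      case 2
      then obtain k where k: "k \<noteq> j" "u i k \<noteq> 0" "J k j \<noteq> 0"
        by (rule sum.not_neutral_contains_not_neutral) auto
      then show ?thesis using J[OF k(3)] u[OF k(2)] by auto
    qed
  qed
  have pow0: "(shift_op mat_scale T a ^^ (2 * m)) (v a) = 0" for a
  proof (rule ext, rule ext, rule ccontr)
    fix i j
    assume "(shift_op mat_scale T a ^^ (2 * m)) (v a) i j \<noteq> 0 i j"
    then show False using pow[of "2 * m" a i j] by auto
  qed
  have sum: "(\<Sum>a\<in>M. f a * v a i j) = f (J i i - J j j) * w i j" for f i j
  proof (cases "w i j = 0")
    case False
    then have "J i i - J j j \<in> M" using supp[OF w] unfolding M_def by auto
    moreover have "(\<Sum>a\<in>M. f a * v a i j) = (\<Sum>a\<in>M. if a = J i i - J j j then f a * w i j else 0)"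
      by (intro sum.cong) (auto simp: v_def)
    ultimately show ?thesis using fM by simp
  qed (simp add: v_def)
  have app: "(\<Sum>a\<in>M. g a) i j = (\<Sum>a\<in>M. g a i j)" for g :: "'f \<Rightarrow> nat \<Rightarrow> nat \<Rightarrow> 'f" and i j
    using fM by (induction rule: finite_induct) auto
  have "(\<Sum>a\<in>M. v a) = w" using sum[of "\<lambda>_. 1"] by (auto simp: fun_eq_iff app)
  then have vW: "v a \<in> W" if "a \<in> M" for a
    using mat_vs.generalized_eigencomponents_mem[OF T W _ fM pow0 _ that] inv w unfolding T_def by auto
  have "(\<lambda>i j. \<psi> (J i i - J j j) * w i j) = (\<Sum>a\<in>M. mat_scale (\<psi> a) (v a))"
    by (auto simp: fun_eq_iff app sum mat_scale_def)
  also have "\<dots> \<in> W" by (intro mat_vs.subspace_sum[OF W] mat_vs.subspace_scale[OF W] vW)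
  finally show ?thesis .
qed

section \<open>Rational functionals on a field of characteristic zero\<close>

lemma exists_rational_functional:
  fixes c :: "'f::field_char_0"
  assumes "c \<noteq> 0"
  obtains \<phi> :: "'f \<Rightarrow> rat" where "\<And>x y. \<phi> (x + y) = \<phi> x + \<phi> y" "\<And>q x. \<phi> (of_rat q * x) = q * \<phi> x" "\<phi> c = 1"
proof -
  interpret v: vector_space_pair "\<lambda>q (x::'f). of_rat q * x" "\<lambda>q (x::rat). q * x"
    by unfold_locales (auto simp: algebra_simps of_rat_add of_rat_mult)
  have "v.vs1.independent {c}" using assms by simp
  then obtain g where "Vector_Spaces.linear (\<lambda>q (x::'f). of_rat q * x) (\<lambda>q (x::rat). q * x) g" "g c = 1"
    using v.linear_independent_extend[of "{c}" "\<lambda>_. 1"] by auto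
  then show ?thesis using that[of g] by (auto simp: Vector_Spaces.linear_iff)
qed

text \<open>Applying \<open>\<phi>\<close> to the hypothesis turns it into \<open>\<Sum>i<m. (\<phi> (c i))\<^sup>2 = 0\<close>.\<close>

lemma all_zero_of_rational_trace:
  fixes c :: "nat \<Rightarrow> 'f::field_char_0"
  assumes "\<And>\<phi> :: 'f \<Rightarrow> rat. (\<And>x y. \<phi> (x + y) = \<phi> x + \<phi> y) \<Longrightarrow> (\<Sum>i<m. c i * of_rat (\<phi> (c i))) = 0"
    and "i < m"
  shows "c i = 0"
proof (rule ccontr)
  assume "c i \<noteq> 0"
  then obtain \<phi> :: "'f \<Rightarrow> rat" where \<phi>: "\<And>x y. \<phi> (x + y) = \<phi> x + \<phi> y"
    "\<And>q x. \<phi> (of_rat q * x) = q * \<phi> x" "\<phi> (c i) = 1"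
    using exists_rational_functional by metis
  have \<phi>0: "\<phi> 0 = 0" using \<phi>(1)[of 0 0] by simp
  have "\<phi> (\<Sum>i\<in>I. c i * of_rat (\<phi> (c i))) = (\<Sum>i\<in>I. (\<phi> (c i))\<^sup>2)" if "finite I" for I
    using that by (induction rule: finite_induct)
      (simp_all add: \<phi> \<phi>0 power2_eq_square mult.commute[of _ "of_rat _"])
  then have "(\<Sum>i<m. (\<phi> (c i))\<^sup>2) = \<phi> 0" using assms(1)[OF \<phi>(1)] by (metis finite_lessThan)
  \<comment> \<open>A vanishing sum of squares forces each square to vanish because the values are
    rational and hence ordered.\<close>
  then have "(\<phi> (c i))\<^sup>2 = 0" using \<phi>0 assms(2) sum_nonneg_eq_0_iff[of "{..<m}" "\<lambda>i. (\<phi> (c i))\<^sup>2"]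
    by auto
  then show False using \<phi>(3) by simp
qed

subsection \<open>Engel's theorem\<close>

lemma (in vector_space) subspace_span_insert_elim:
  assumes "subspace U" "x \<in> span (insert z U)"
  obtains c u where "u \<in> U" "x = scale c z + u"
proof -
  obtain c where "x - scale c z \<in> span U" using assms(2) span_breakdown_eq by blast
  then have "x - scale c z \<in> U" using assms(1) span_eq_iff by blast
  then show ?thesis using that[of "x - scale c z" c] by simp
qed

text \<open>A term of minimal dimension cannot shrink any further.\<close>

lemma (in finite_dimensional_vector_space) subspace_chain_stabilizes:
  assumes "\<And>i. subspace (F i)" "\<And>i. F (Suc i) \<subseteq> F i"
  shows "\<exists>i::nat. F (Suc i) = F i"
proof -
  obtain i where "\<And>j. dim (F i) \<le> dim (F j)"
    using ex_has_least_nat[of "\<lambda>_. True" _ "\<lambda>i. dim (F i)"] by blast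
  then show ?thesis using subspace_dim_equal[OF assms(1) assms(1) assms(2)] by blast
qed

context lie_algebra
begin

abbreviation "bs \<equiv> bracket_span scale br"

lemma linear_br: "Vector_Spaces.linear scale scale (br x)"
  by (simp add: linear_iff_hom br_add_right br_scale_right)

sublocale br: Vector_Spaces.linear scale scale "br x" for x
  by (rule linear_br)

lemma br_zero_left: "br 0 y = 0"
  using br_scale_left[of 0 0 y] by simp

lemma br_skew: "br x y = - br y x"
proof -
  have "br (x + y) (x + y) = br x y + br y x"
    by (simp only: br_add_left br_add_right) (simp add: br_self)
  then show ?thesis by (simp add: br_self eq_neg_iff_add_eq_0)
qed

lemma br_leibniz: "br x (br y z) = br (br x y) z + br y (br x z)"
proof -
  have "br x (br y z) = - br y (br z x) - br z (br x y)"
    using jacobi[of x y z] by (metis add_diff_cancel_right' add.commute diff_0 diff_conv_add_uminus)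
  then show ?thesis
    by (simp add: br_skew[of z x] br_skew[of z "br x y"] br.neg)
qed

lemma subspace_bs: "subspace (bs A C)"
  unfolding bracket_span_def by (rule subspace_span)

lemma br_mem_bs: "a \<in> A \<Longrightarrow> b \<in> C \<Longrightarrow> br a b \<in> bs A C"
  unfolding bracket_span_def by (rule span_base) blast

lemma bs_least:
  assumes "subspace S" "\<And>a b. a \<in> A \<Longrightarrow> b \<in> C \<Longrightarrow> br a b \<in> S"
  shows "bs A C \<subseteq> S"
  unfolding bracket_span_def using assms by (intro span_minimal) auto

lemma bs_mono: "A \<subseteq> A' \<Longrightarrow> C \<subseteq> C' \<Longrightarrow> bs A C \<subseteq> bs A' C'"
  unfolding bracket_span_def by (intro span_mono) blast

text \<open>This is the conclusion of Engel's theorem: all products of \<open>k\<close> operators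
  \<open>ad u\<close> with \<open>u\<close> in \<open>U\<close> vanish on the whole algebra, for one
  common \<open>k\<close>.\<close>

definition acts_nilpotently :: "'a set \<Rightarrow> bool" where
  "acts_nilpotently U \<longleftrightarrow> (\<exists>k. (bs U ^^ k) UNIV = {0})"

lemma bs_funpow_mono: "A \<subseteq> A' \<Longrightarrow> C \<subseteq> C' \<Longrightarrow> (bs A ^^ k) C \<subseteq> (bs A' ^^ k) C'"
  by (induction k) (auto intro: bs_mono[THEN subsetD])

text \<open>Iterating the inclusion puts \<open>V\<close> into every iterate of \<open>bs U\<close>,
  in particular into the one that is zero.\<close>

lemma acts_nilpotently_fixed:
  assumes "acts_nilpotently U" "V \<subseteq> bs U V"
  shows "V \<subseteq> {0}"
proof -
  have "V \<subseteq> (bs U ^^ k) UNIV" for k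
    by (induction k) (use assms(2) in \<open>auto dest: bs_mono[THEN subsetD, OF order_refl]\<close>)
  then show ?thesis using assms(1) unfolding acts_nilpotently_def by metis
qed

end

locale fd_lie_algebra = lie_algebra scale br + finite_dimensional_vector_space scale Basis
  for scale :: "'k::field \<Rightarrow> 'a::ab_group_add \<Rightarrow> 'a" and br Basis
begin

text \<open>If \<open>V = [U + \<langle>z\<rangle>, V]\<close>, then \<open>ad z\<close> preserves \<open>C = [U, V]\<close>, and iterating \<open>V = C + [z, V]\<close>
  gives \<open>V = C\<close>, so \<open>V\<close> is zero.\<close>

lemma acts_nilpotently_insert:
  assumes U: "subspace U" "acts_nilpotently U"
    and z: "\<And>u. u \<in> U \<Longrightarrow> br z u \<in> U" "\<And>v. (br z ^^ N) v = 0"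
  shows "acts_nilpotently (span (insert z U))"
proof -
  let ?U = "span (insert z U)"
  define F where "F i = (bs ?U ^^ i) UNIV" for i
  have sub: "subspace (F i)" for i by (cases i) (simp_all add: F_def subspace_bs)
  have "F (Suc i) \<subseteq> F i" for i
    by (induction i) (simp_all add: F_def bs_mono)
  then obtain i where "F (Suc i) = F i" using subspace_chain_stabilizes[of F] sub by blast
  then have V: "bs ?U (F i) = F i" by (simp add: F_def)
  define V where "V = F i"
  define C where "C = bs U V"
  have subV: "subspace V" unfolding V_def by (rule sub)
  have subC: "subspace C" unfolding C_def by (rule subspace_bs)
  have zV: "br z v \<in> V" if "v \<in> V" for v
    using br_mem_bs[of z ?U v V] V that unfolding V_def by (simp add: span_base)
  \<comment> \<open>By the Leibniz rule \<open>C\<close> is invariant under \<open>ad z\<close>, as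
    \<open>ad z\<close> preserves both \<open>U\<close> and \<open>V\<close>.\<close>
  have "C \<subseteq> {c. br z c \<in> C}"
    unfolding C_def
  proof (rule bs_least)
    show "subspace {c. br z c \<in> bs U V}"
      using subspace_bs unfolding subspace_def by (auto simp: br_add_right br_scale_right br.zero)
    fix u v assume uv: "u \<in> U" "v \<in> V"
    show "br u v \<in> {c. br z c \<in> bs U V}"
      using uv by (auto simp: br_leibniz[of z u v] intro!: subspace_add[OF subspace_bs] br_mem_bs z(1) zV)
  qed
  then have zC: "br z c \<in> C" if "c \<in> C" for c using that by auto
  have "V \<subseteq> {c + br z v | c v. c \<in> C \<and> v \<in> V}"
  proof -
    have "bs ?U V \<subseteq> {c + br z v | c v. c \<in> C \<and> v \<in> V}"
    proof (rule bs_least)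
      have "subspace {c + w | c w. c \<in> C \<and> w \<in> br z ` V}"
        by (intro subspace_sums subC br.subspace_image subV)
      moreover have "{c + w | c w. c \<in> C \<and> w \<in> br z ` V} = {c + br z v | c v. c \<in> C \<and> v \<in> V}"
        by auto
      ultimately show "subspace {c + br z v | c v. c \<in> C \<and> v \<in> V}" by simp
    next
      fix x v assume x: "x \<in> ?U" and v: "v \<in> V"
      obtain c u where u: "u \<in> U" "x = scale c z + u" using subspace_span_insert_elim[OF U(1) x] .
      have "br x v = br u v + br z (scale c v)" using u by (simp add: br_add_left br_scale_left br_scale_right)
      then show "br x v \<in> {c + br z v | c v. c \<in> C \<and> v \<in> V}"
        using br_mem_bs[OF u(1) v] subspace_scale[OF subV v] unfolding C_def by blast
    qed
    then show ?thesis using V unfolding V_def by simp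
  qed
  then have split: "\<exists>c\<in>C. \<exists>v'\<in>V. v = c + br z v'" if "v \<in> V" for v using that by blast
  have "\<exists>c\<in>C. \<exists>v'\<in>V. v = c + (br z ^^ j) v'" if "v \<in> V" for v j
    using that
  proof (induction j arbitrary: v)
    case 0
    then show ?case using subspace_0[OF subC] by force
  next
    case (Suc j)
    obtain c v' where 1: "c \<in> C" "v' \<in> V" "v = c + br z v'" using split[OF Suc.prems] by blast
    obtain c' v'' where 2: "c' \<in> C" "v'' \<in> V" "v' = c' + (br z ^^ j) v''" using Suc.IH[OF 1(2)] by blast
    have "v = (c + br z c') + (br z ^^ Suc j) v''" using 1 2 by (simp add: br_add_right add.assoc)
    then show ?case using subspace_add[OF subC 1(1) zC[OF 2(1)]] 2(2) by blast
  qed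
  \<comment> \<open>For \<open>j = N\<close> the summand outside \<open>C\<close> is zero.\<close>
  from this[of _ N] have "V \<subseteq> C" by (auto simp: z(2))
  then have "V \<subseteq> {0}" using acts_nilpotently_fixed[OF U(2)] unfolding C_def by blast
  then have "F i = {0}" using subspace_0[OF subV] unfolding V_def by auto
  then show ?thesis unfolding acts_nilpotently_def F_def by blast
qed

text \<open>A maximal subalgebra \<open>U \<subseteq> P\<close> that acts nilpotently is normalized by an element outside \<open>U\<close> unless
  \<open>U = P\<close>; adjoining this element contradicts maximality.\<close>

theorem engel:
  assumes P: "subspace P" "\<And>x y. x \<in> P \<Longrightarrow> y \<in> P \<Longrightarrow> br x y \<in> P"
    and nil: "\<And>x. x \<in> P \<Longrightarrow> \<exists>N. \<forall>v. (br x ^^ N) v = 0"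
  shows "acts_nilpotently P"
proof -
  define good where "good U \<longleftrightarrow> subspace U \<and> U \<subseteq> P \<and> (\<forall>x\<in>U. \<forall>y\<in>U. br x y \<in> U) \<and> acts_nilpotently U" for U
  have "bs {0} UNIV = {0}"
    using bs_least[OF subspace_single_0, of "{0}" UNIV] subspace_0[OF subspace_bs, of "{0}" UNIV]
    by (auto simp: br_zero_left)
  then have "(bs {0} ^^ 1) UNIV = {0}" by simp
  then have "acts_nilpotently {0}" unfolding acts_nilpotently_def by blast
  then have "good {0}" using subspace_0[OF P(1)] by (auto simp: good_def br_zero_left)
  then obtain U where U: "good U" and max: "\<And>U'. good U' \<Longrightarrow> dim U' \<le> dim U"
    using ex_has_greatest_nat[of good "{0}" dim "Suc dimension"] dim_subset_UNIV by (auto simp: less_Suc_eq_le)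
  note U' = U[unfolded good_def]
  show ?thesis
  proof (cases "U = P")
    case False
    \<comment> \<open>The chain \<open>G\<close> starts at \<open>P\<close>, which is not contained
      in \<open>U\<close>, and eventually enters \<open>U\<close>. An element outside
      \<open>U\<close> of the term just before the entry is carried into \<open>U\<close> by every
      element of \<open>U\<close>, so it normalizes \<open>U\<close>.\<close>
    define G where "G j = (bs U ^^ j) P" for j
    obtain k where "(bs U ^^ k) UNIV = {0}" using U' unfolding acts_nilpotently_def by auto
    then have "G k \<subseteq> U" using bs_funpow_mono[OF order_refl subset_UNIV, of k U P] subspace_0 U' unfolding G_def by auto
    moreover have "\<not> G 0 \<subseteq> U" using False U' unfolding G_def by auto
    ultimately obtain j where j: "\<not> G j \<subseteq> U" "G (Suc j) \<subseteq> U"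
      using ex_least_nat_less[of "\<lambda>j. G j \<subseteq> U" k] by blast
    then obtain z where z: "z \<in> G j" "z \<notin> U" by blast
    have "G j \<subseteq> P"
      unfolding G_def
    proof (induction j)
      case (Suc j)
      have "bs U ((bs U ^^ j) P) \<subseteq> P"
        by (rule bs_least[OF P(1)]) (use Suc U' P(2) in blast)
      then show ?case by simp
    qed simp
    then have zP: "z \<in> P" using z by blast
    have uz: "br u z \<in> U" if "u \<in> U" for u
      using br_mem_bs[OF that z(1)] j(2) unfolding G_def by auto
    then have zu: "br z u \<in> U" if "u \<in> U" for u
      using that subspace_neg U' by (metis br_skew)
    let ?U = "span (insert z U)"
    obtain N where "\<And>v. (br z ^^ N) v = 0" using nil[OF zP] by auto
    then have "acts_nilpotently ?U" using acts_nilpotently_insert U' zu by blast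
    moreover have "?U \<subseteq> P" using U' zP P(1) by (intro span_minimal) auto
    moreover have "br x y \<in> ?U" if xy: "x \<in> ?U" "y \<in> ?U" for x y
    proof -
      have sU: "subspace U" using U' by simp
      obtain a u where u: "u \<in> U" "x = scale a z + u" using subspace_span_insert_elim[OF sU xy(1)] .
      obtain b w where w: "w \<in> U" "y = scale b z + w" using subspace_span_insert_elim[OF sU xy(2)] .
      have "br x y = scale a (br z w) + scale b (br u z) + br u w"
        unfolding u w by (simp add: br_add_left br_add_right br_scale_left br_scale_right br_self)
      moreover have "br u w \<in> U" using u(1) w(1) U' by blast
      ultimately have "br x y \<in> U"
        using zu[OF w(1)] uz[OF u(1)] subspace_add[OF sU] subspace_scale[OF sU] by metis
      then show ?thesis by (simp add: span_base)
    qed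
    ultimately have "good ?U" unfolding good_def by auto
    then have "dim ?U \<le> dim U" by (rule max)
    moreover have "U \<subseteq> ?U" by (auto intro: span_base)
    ultimately have "U = ?U" using subspace_dim_equal[of U ?U] U' by simp
    then show ?thesis using z(2) span_base[of z "insert z U"] by auto
  qed (use U' in simp)
qed

section \<open>Perfect subalgebras and the derived series\<close>

lemma perfect_ad_nilpotent_trivial:
  assumes "subspace P" "bs P P = P" "\<And>x. x \<in> P \<Longrightarrow> \<exists>N. \<forall>v. (br x ^^ N) v = 0"
  shows "P = {0}"
proof -
  have "acts_nilpotently P"
    using assms br_mem_bs[of _ P _ P] by (intro engel) auto
  then show ?thesis using acts_nilpotently_fixed[of P P] assms(1,2) subspace_0 by auto
qed

text \<open>Reduces solvability to showing that a perfect term of the derived series is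
  zero.\<close>

lemma derived_series_stabilizes: 
  obtains k where "subspace (derived_series scale br k)"
    "bs (derived_series scale br k) (derived_series scale br k) = derived_series scale br k"
proof -
  have sub: "subspace (derived_series scale br i)" for i by (cases i) (simp_all add: subspace_bs)
  have "derived_series scale br (Suc i) \<subseteq> derived_series scale br i" for i
    by (induction i) (simp_all add: bs_mono)
  then obtain k where "derived_series scale br (Suc k) = derived_series scale br k"
    using subspace_chain_stabilizes[of "derived_series scale br"] sub by blast
  then show ?thesis using that[OF sub] by simp
qed

lemma perfect_subset_lower_central:
  assumes "bs P P = P"
  shows "P \<subseteq> lower_central scale br n"
proof (induction n rule: induct_nat_012)
  case (ge2 n)
  then show ?case using bs_mono[of P UNIV P "lower_central scale br (Suc n)"] assms by simp
qed simp_all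

end

subsection \<open>Faithful matrix representations of the endomorphism algebra\<close>

context
  fixes P Q :: "'f::comm_ring_1 mat" and n
  assumes P: "P \<in> carrier_mat n n" and Q: "Q \<in> carrier_mat n n" and PQ: "P * Q = 1\<^sub>m n"
begin

lemma conj_mat_cancel_left:
  assumes M: "M \<in> carrier_mat n n"
  shows "P * (Q * M * P) = M * P"
proof -
  have QM: "Q * M \<in> carrier_mat n n" using Q M by simp
  have "P * (Q * M * P) = P * (Q * M) * P" by (rule assoc_mult_mat[OF P QM P, symmetric])
  also have "P * (Q * M) = P * Q * M" by (rule assoc_mult_mat[OF P Q M, symmetric])
  finally show ?thesis using M PQ by simp
qed

lemma conj_mat_cancel:
  assumes M: "M \<in> carrier_mat n n"
  shows "P * (Q * M * P) * Q = M"
  unfolding conj_mat_cancel_left[OF M] assoc_mult_mat[OF M P Q] using M PQ by simp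

lemma conj_mat_mult:
  assumes M: "M \<in> carrier_mat n n" and N: "N \<in> carrier_mat n n"
  shows "Q * (M * N) * P = (Q * M * P) * (Q * N * P)"
proof -
  have QM: "Q * M \<in> carrier_mat n n" using Q M by simp
  have QNP: "Q * N * P \<in> carrier_mat n n" using P Q N by simp
  have "(Q * M * P) * (Q * N * P) = Q * M * (N * P)"
    unfolding assoc_mult_mat[OF QM P QNP] conj_mat_cancel_left[OF N] ..
  also have "\<dots> = Q * M * N * P" by (rule assoc_mult_mat[OF QM N P, symmetric])
  finally show ?thesis unfolding assoc_mult_mat[OF Q M N] ..
qed

end

text \<open>The values of \<open>\<rho>\<close> are \<open>m\<close> by \<open>m\<close> matrices, extended by zero to all indices. Only the images of
  linear maps are meaningful.\<close>

locale matrix_rep = vector_space scale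
  for scale :: "'k::field \<Rightarrow> 'a::ab_group_add \<Rightarrow> 'a" +
  fixes m :: nat and \<rho> :: "('a \<Rightarrow> 'a) \<Rightarrow> nat \<Rightarrow> nat \<Rightarrow> 'f::field" and h :: "'k \<Rightarrow> 'f"
  assumes rep_comp: "Vector_Spaces.linear scale scale f \<Longrightarrow> Vector_Spaces.linear scale scale g \<Longrightarrow>
      \<rho> (\<lambda>x. f (g x)) i j = (\<Sum>k<m. \<rho> f i k * \<rho> g k j)"
    and rep_add: "Vector_Spaces.linear scale scale f \<Longrightarrow> Vector_Spaces.linear scale scale g \<Longrightarrow>
      \<rho> (\<lambda>x. f x + g x) i j = \<rho> f i j + \<rho> g i j"
    and rep_diff: "Vector_Spaces.linear scale scale f \<Longrightarrow> Vector_Spaces.linear scale scale g \<Longrightarrow>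
      \<rho> (\<lambda>x. f x - g x) i j = \<rho> f i j - \<rho> g i j"
    and rep_scale: "Vector_Spaces.linear scale scale f \<Longrightarrow> \<rho> (\<lambda>x. scale c (f x)) i j = h c * \<rho> f i j"
    and rep_support: "\<rho> f i j \<noteq> 0 \<Longrightarrow> i < m \<and> j < m"
    and rep_faithful: "Vector_Spaces.linear scale scale f \<Longrightarrow> (\<And>i j. \<rho> f i j = 0) \<Longrightarrow> f x = 0"

text \<open>Coordinate matrices in a basis are mapped to the algebraic closure by
  \<open>to_ac\<close> and conjugated by the matrix that brings \<open>f0\<close> into block
  triangular form. Conjugation is multiplicative and reversible, so the representation stays
  faithful.\<close>

lemma (in finite_dimensional_vector_space) exists_block_triangular_matrix_rep:
  assumes f0: "Vector_Spaces.linear scale scale f0"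
  obtains m and \<rho> :: "('b \<Rightarrow> 'b) \<Rightarrow> nat \<Rightarrow> nat \<Rightarrow> 'a alg_closure"
  where "matrix_rep scale m \<rho> to_ac"
    "\<And>i j. \<rho> f0 i j \<noteq> 0 \<Longrightarrow> i < m \<and> j < m \<and> i \<le> j \<and> \<rho> f0 i i = \<rho> f0 j j"
proof -
  obtain bs where bs: "distinct bs" "set bs = Basis" using finite_distinct_list[OF finite_Basis] by auto
  define m where "m = length bs"
  define co where "co v i = representation Basis v (bs ! i)" for v i
  have inj: "inj_on ((!) bs) {..<m}" "(!) bs ` {..<m} = Basis"
    using bs by (auto simp: m_def inj_on_def nth_eq_iff_index_eq set_conv_nth)
  have mem: "v \<in> span Basis" for v by (simp add: span_Basis)
  have expand: "v = (\<Sum>k<m. scale (co v k) (bs ! k))" for v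
  proof -
    have "v = (\<Sum>b\<in>Basis. scale (representation Basis v b) b)"
      using sum_representation_eq[OF independent_Basis mem finite_Basis order_refl] by simp
    also have "\<dots> = (\<Sum>k<m. scale (co v k) (bs ! k))"
      unfolding inj(2)[symmetric] co_def by (subst sum.reindex[OF inj(1)]) simp
    finally show ?thesis .
  qed
  have co_lin: "co (v + w) i = co v i + co w i" "co (v - w) i = co v i - co w i"
    "co (scale c v) i = c * co v i" for v w c i
    by (simp_all add: co_def representation_add representation_diff representation_scale
        independent_Basis mem)
  have co_sum: "co (\<Sum>k\<in>I. g k) i = (\<Sum>k\<in>I. co (g k) i)" for g :: "nat \<Rightarrow> 'b" and I i
    by (simp add: co_def representation_sum independent_Basis mem)
  define A where "A f = mat m m (\<lambda>(i,j). to_ac (co (f (bs ! j)) i))" for f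
  have A: "A f \<in> carrier_mat m m" for f by (simp add: A_def)
  obtain J P Q where w: "similar_mat_wit (A f0) J P Q"
    and J: "\<And>i j. i < m \<Longrightarrow> j < m \<Longrightarrow> J $$ (i,j) \<noteq> 0 \<Longrightarrow> i \<le> j \<and> J $$ (i,i) = J $$ (j,j)"
    using similar_block_triangular[OF A] by blast
  note PQ = similar_mat_witD2[OF A w]
  define R where "R f = Q * A f * P" for f
  have QA: "Q * A f \<in> carrier_mat m m" for f by (rule mult_carrier_mat[OF PQ(7) A])
  have R: "R f \<in> carrier_mat m m" for f unfolding R_def by (rule mult_carrier_mat[OF QA PQ(6)])
  then have dim_R [simp]: "dim_row (R f) = m" "dim_col (R f) = m" for f by auto
  define \<rho> where "\<rho> f i j = (if i < m \<and> j < m then R f $$ (i,j) else 0)" for f i j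
  have A_comp: "A (\<lambda>x. f (g x)) = A f * A g" if "Vector_Spaces.linear scale scale f" for f g
  proof (rule eq_matI)
    interpret f: Vector_Spaces.linear scale scale f by (rule that)
    fix i j assume ij: "i < dim_row (A f * A g)" "j < dim_col (A f * A g)"
    have "f (g (bs ! j)) = (\<Sum>k<m. scale (co (g (bs ! j)) k) (f (bs ! k)))"
      by (subst expand[of "g (bs ! j)"]) (simp add: f.sum f.scale)
    then have "co (f (g (bs ! j))) i = (\<Sum>k<m. co (f (bs ! k)) i * co (g (bs ! j)) k)"
      by (simp add: co_sum co_lin mult.commute)
    then show "A (\<lambda>x. f (g x)) $$ (i,j) = (A f * A g) $$ (i,j)"
      using ij by (simp add: A_def scalar_prod_def to_ac_sum atLeast0LessThan)
  qed (simp_all add: A_def)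
  have A_add: "A (\<lambda>x. f x + g x) = A f + A g" for f g
    by (rule eq_matI) (auto simp: A_def co_lin)
  have A_diff: "A (\<lambda>x. f x - g x) = A f - A g" for f g
    by (rule eq_matI) (auto simp: A_def co_lin)
  have A_scale: "A (\<lambda>x. scale c (f x)) = to_ac c \<cdot>\<^sub>m A f" for f c
    by (rule eq_matI) (auto simp: A_def co_lin)
  have R_comp: "R (\<lambda>x. f (g x)) = R f * R g" if "Vector_Spaces.linear scale scale f" for f g
    unfolding R_def using conj_mat_mult[OF PQ(6,7,1) A A, of f g] A_comp[OF that, of g] by (simp only:)
  have R_add: "R (\<lambda>x. f x + g x) = R f + R g" for f g
    unfolding R_def A_add mult_add_distrib_mat[OF PQ(7) A A] by (rule add_mult_distrib_mat[OF QA QA PQ(6)])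
  have R_diff: "R (\<lambda>x. f x - g x) = R f - R g" for f g
    unfolding R_def A_diff mult_minus_distrib_mat[OF PQ(7) A A] by (rule minus_mult_distrib_mat[OF QA QA PQ(6)])
  have R_scale: "R (\<lambda>x. scale c (f x)) = to_ac c \<cdot>\<^sub>m R f" for f c
    unfolding R_def A_scale mult_smult_distrib[OF PQ(7) A] by (rule mult_smult_assoc_mat[OF QA PQ(6)])
  have "matrix_rep scale m \<rho> to_ac"
  proof unfold_locales
    fix f g :: "'b \<Rightarrow> 'b" and i j :: nat
    assume f: "Vector_Spaces.linear scale scale f"
    show "\<rho> (\<lambda>x. f (g x)) i j = (\<Sum>k<m. \<rho> f i k * \<rho> g k j)"
      by (auto simp: \<rho>_def R_comp[OF f, of g] scalar_prod_def atLeast0LessThan)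
    show "\<rho> (\<lambda>x. f x + g x) i j = \<rho> f i j + \<rho> g i j" by (simp add: \<rho>_def R_add)
    show "\<rho> (\<lambda>x. f x - g x) i j = \<rho> f i j - \<rho> g i j" by (simp add: \<rho>_def R_diff)
    show "\<rho> (\<lambda>x. scale c (f x)) i j = to_ac c * \<rho> f i j" for c by (simp add: \<rho>_def R_scale)
  next
    show "\<rho> f i j \<noteq> 0 \<Longrightarrow> i < m \<and> j < m" for f i j by (auto simp: \<rho>_def split: if_splits)
  next
    fix f :: "'b \<Rightarrow> 'b" and x
    assume f: "Vector_Spaces.linear scale scale f" and z: "\<And>i j. \<rho> f i j = 0"
    interpret f: Vector_Spaces.linear scale scale f by (rule f)
    have R0: "R f = 0\<^sub>m m m"
    proof (rule eq_matI)
      fix i j assume "i < dim_row (0\<^sub>m m m :: 'a alg_closure mat)" "j < dim_col (0\<^sub>m m m :: 'a alg_closure mat)"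
      then show "R f $$ (i,j) = 0\<^sub>m m m $$ (i,j)" using z[of i j] by (simp add: \<rho>_def)
    qed simp_all
    have "A f = P * R f * Q" unfolding R_def by (rule conj_mat_cancel[OF PQ(6,7,1) A, symmetric])
    also have "\<dots> = 0\<^sub>m m m" unfolding R0 using PQ by simp
    finally have "A f $$ (i,j) = 0" if "i < m" "j < m" for i j using that by simp
    then have "co (f (bs ! j)) i = 0" if "i < m" "j < m" for i j using that by (simp add: A_def)
    then have b0: "f (bs ! j) = 0" if "j < m" for j using that expand[of "f (bs ! j)"] by simp
    have "f x = (\<Sum>k<m. scale (co x k) (f (bs ! k)))"
      by (subst expand[of x]) (simp add: f.sum f.scale)
    then show "f x = 0" using b0 by simp
  qed
  moreover have "\<rho> f0 i j = J $$ (i,j)" if "i < m" "j < m" for i j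
  proof -
    have "J = R f0"
      unfolding R_def
      using similar_mat_witD2(3)[OF PQ(5) similar_mat_wit_sym[OF w]] .
    then show ?thesis using that by (simp add: \<rho>_def)
  qed
  ultimately show ?thesis using that J by (metis \<rho>_def)
qed

subsection \<open>Vanishing of the Killing form and Cartan's criterion\<close>

context vector_space
begin

lemma linear_comp_fun:
  "Vector_Spaces.linear scale scale f \<Longrightarrow> Vector_Spaces.linear scale scale g \<Longrightarrow>
    Vector_Spaces.linear scale scale (\<lambda>x. f (g x))"
  by (simp add: Vector_Spaces.linear_iff)

lemma linear_funpow:
  assumes "Vector_Spaces.linear scale scale f"
  shows "Vector_Spaces.linear scale scale (f ^^ n)"
proof (induction n)
  case 0
  then show ?case using vector_space_axioms by (simp add: Vector_Spaces.linear_iff)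
next
  case (Suc n)
  then show ?case using linear_comp_fun[OF assms Suc] by (simp add: comp_def)
qed

end

text \<open>For positive \<open>n\<close> the bracket lands in the next term, which is contained in
  the present one; at the dummy index 0 the set is everything.\<close>

lemma (in lie_algebra) lower_central_ideal:
  "y \<in> lower_central scale br n \<Longrightarrow> br z y \<in> lower_central scale br n"
proof -
  have decr: "lower_central scale br (Suc n) \<subseteq> lower_central scale br n" for n
    by (induction n rule: induct_nat_012) (simp_all add: bs_mono)
  assume y: "y \<in> lower_central scale br n"
  show ?thesis
  proof (cases n)
    case (Suc k)
    then have "br z y \<in> lower_central scale br (Suc n)" using y by (simp add: br_mem_bs)
    then show ?thesis using decr by blast
  qed simp
qed

section \<open>Traces in a matrix representation\<close>

context matrix_rep
begin

definition trace :: "('a \<Rightarrow> 'a) \<Rightarrow> 'f" where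
  "trace f = (\<Sum>i<m. \<rho> f i i)"

lemma trace_comp:
  assumes "Vector_Spaces.linear scale scale f" "Vector_Spaces.linear scale scale g"
  shows "trace (\<lambda>x. f (g x)) = (\<Sum>i<m. \<Sum>k<m. \<rho> f i k * \<rho> g k i)"
  unfolding trace_def rep_comp[OF assms] ..

lemma trace_comp_commute:
  assumes "Vector_Spaces.linear scale scale f" "Vector_Spaces.linear scale scale g"
  shows "trace (\<lambda>x. f (g x)) = trace (\<lambda>x. g (f x))"
  unfolding trace_comp[OF assms] trace_comp[OF assms(2,1)]
  by (subst sum.swap) (simp add: mult.commute)

lemma trace_add:
  assumes "Vector_Spaces.linear scale scale f" "Vector_Spaces.linear scale scale g"
  shows "trace (\<lambda>x. f x + g x) = trace f + trace g"
  unfolding trace_def rep_add[OF assms] by (rule sum.distrib)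

lemma trace_diff:
  assumes "Vector_Spaces.linear scale scale f" "Vector_Spaces.linear scale scale g"
  shows "trace (\<lambda>x. f x - g x) = trace f - trace g"
  unfolding trace_def rep_diff[OF assms] by (rule sum_subtractf)

lemma trace_scale:
  assumes "Vector_Spaces.linear scale scale f"
  shows "trace (\<lambda>x. scale c (f x)) = h c * trace f"
  unfolding trace_def rep_scale[OF assms] by (simp add: sum_distrib_left)

text \<open>The power with exponent \<open>k + 1\<close> is supported where
  \<open>i + k < j\<close>. For \<open>k = m\<close> no index pair below \<open>m\<close> is left,
  and faithfulness turns the zero matrix into the zero map.\<close>

lemma strictly_triangular_nilpotent:
  assumes f: "Vector_Spaces.linear scale scale f"
    and tri: "\<And>i j. \<rho> f i j \<noteq> 0 \<Longrightarrow> i < j"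
  shows "\<exists>N. \<forall>v. (f ^^ N) v = 0"
proof -
  have "\<rho> (f ^^ Suc k) i j \<noteq> 0 \<Longrightarrow> i + k < j" for i j k
  proof (induction k arbitrary: i j)
    case 0
    then show ?case using tri by simp
  next
    case (Suc k)
    have "\<rho> (f ^^ Suc (Suc k)) i j = \<rho> (\<lambda>v. f ((f ^^ Suc k) v)) i j" by (simp add: comp_def)
    also have "\<dots> = (\<Sum>l<m. \<rho> f i l * \<rho> (f ^^ Suc k) l j)"
      by (rule rep_comp[OF f linear_funpow[OF f]])
    finally have eq: "\<rho> (f ^^ Suc (Suc k)) i j = (\<Sum>l<m. \<rho> f i l * \<rho> (f ^^ Suc k) l j)" .
    obtain l where "\<rho> f i l * \<rho> (f ^^ Suc k) l j \<noteq> 0"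
      using Suc.prems unfolding eq by (rule sum.not_neutral_contains_not_neutral)
    then have "\<rho> f i l \<noteq> 0" "\<rho> (f ^^ Suc k) l j \<noteq> 0" using mult_not_zero by blast+
    then have "i < l" "l + k < j" using tri Suc.IH by blast+
    then show ?case by simp
  qed
  then have "\<rho> (f ^^ Suc m) i j = 0" for i j using rep_support[of "f ^^ Suc m" i j] by fastforce
  then have "(f ^^ Suc m) v = 0" for v by (rule rep_faithful[OF linear_funpow[OF f]])
  then show ?thesis by blast
qed

end

section \<open>Trace identities for commuting derivations\<close>

locale lie_algebra_rep = lie_algebra scale br + matrix_rep scale m \<rho> h
  for scale :: "'k::field \<Rightarrow> 'a::ab_group_add \<Rightarrow> 'a" and br m
    and \<rho> :: "('a \<Rightarrow> 'a) \<Rightarrow> nat \<Rightarrow> nat \<Rightarrow> 'f::field_char_0" and h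
begin

lemma ad_br: "br (br x y) = (\<lambda>v. br x (br y v) - br y (br x v))"
  by (auto simp: br_leibniz[of x y])

lemma ad_add: "br (x + y) = (\<lambda>v. br x v + br y v)"
  by (auto simp: br_add_left)

lemma ad_scale: "br (scale c x) = (\<lambda>v. scale c (br x v))"
  by (auto simp: br_scale_left)

lemma linear_zero_fun: "Vector_Spaces.linear scale scale (\<lambda>v. 0)"
  by (simp add: linear_iff_hom)

text \<open>Lets the vanishing of a trace pass from generators to their span.\<close>

lemma subspace_trace_ad:
  assumes g: "Vector_Spaces.linear scale scale g"
  shows "subspace {y. trace (\<lambda>v. g (br y v)) = 0}"
proof -
  interpret g: Vector_Spaces.linear scale scale g by (rule g)
  have "trace (\<lambda>v. 0) = 0"
    using trace_diff[OF linear_zero_fun linear_zero_fun] by simp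
  then show ?thesis
    unfolding subspace_def
    by (auto simp: br_zero_left g.zero br_add_left g.add br_scale_left g.scale
        trace_add trace_scale linear_comp_fun[OF g linear_br])
qed

context
  fixes D :: "('a \<Rightarrow> 'a) set"
  assumes D: "D \<subseteq> derivations scale br" and abelian: "\<And>d e x. d \<in> D \<Longrightarrow> e \<in> D \<Longrightarrow> d (e x) = e (d x)"
begin

lemma linear_D: "d \<in> D \<Longrightarrow> Vector_Spaces.linear scale scale d"
  using D by (auto simp: derivations_def)

lemma derivation_D: "d \<in> D \<Longrightarrow> d (br x y) = br (d x) y + br x (d y)"
  using D by (auto simp: derivations_def)

text \<open>The map \<open>ad (e u)\<close> is the commutator of \<open>e\<close> and
  \<open>ad u\<close>. As \<open>d\<close> and \<open>e\<close> commute, composing it with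
  \<open>d\<close> gives the commutator of \<open>e\<close> with \<open>d \<circ> ad u\<close>,
  which has trace zero.\<close>

lemma trace_derivation_ad:
  assumes d: "d \<in> D" and y: "y \<in> span (\<Union>e\<in>D. range e)"
  shows "trace (\<lambda>v. d (br y v)) = 0"
proof -
  have "trace (\<lambda>v. d (br (e u) v)) = 0" if e: "e \<in> D" for e u
  proof -
    note ld = linear_D[OF d] and le = linear_D[OF e]
    interpret d: Vector_Spaces.linear scale scale d by (rule ld)
    have ldb: "Vector_Spaces.linear scale scale (\<lambda>v. d (br u v))" by (rule linear_comp_fun[OF ld linear_br])
    have "(\<lambda>v. d (br (e u) v)) = (\<lambda>v. e (d (br u v)) - d (br u (e v)))"
      using derivation_D[OF e, of u] by (auto simp: abelian[OF e d] d.add)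
    then show ?thesis
      using trace_diff[OF linear_comp_fun[OF le ldb] linear_comp_fun[OF ldb le]]
        trace_comp_commute[OF le ldb] by simp
  qed
  then have "(\<Union>e\<in>D. range e) \<subseteq> {y. trace (\<lambda>v. d (br y v)) = 0}" by auto
  then have "span (\<Union>e\<in>D. range e) \<subseteq> {y. trace (\<lambda>v. d (br y v)) = 0}"
    by (rule span_minimal) (rule subspace_trace_ad[OF linear_D[OF d]])
  then show ?thesis using y by auto
qed

text \<open>For a generator \<open>d z\<close> of the span, \<open>ad (d z)\<close> is the
  commutator of \<open>d\<close> and \<open>ad z\<close>. Cyclicity of the trace moves
  \<open>d\<close> to the front and leaves the trace of \<open>d \<circ> ad [z, y]\<close>, where
  \<open>[z, y]\<close> is again in \<open>S\<close>. Linearity then covers every \<open>x\<close>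
  in the span.\<close>

lemma killing_form_vanishes:
  assumes S: "S \<subseteq> span (\<Union>e\<in>D. range e)" "\<And>z y. y \<in> S \<Longrightarrow> br z y \<in> S"
    and x: "x \<in> S" and y: "y \<in> S"
  shows "trace (\<lambda>v. br x (br y v)) = 0"
proof -
  have "trace (\<lambda>v. br y (br (d z) v)) = 0" if d: "d \<in> D" for d z
  proof -
    note ld = linear_D[OF d]
    interpret d: Vector_Spaces.linear scale scale d by (rule ld)
    have lyd: "Vector_Spaces.linear scale scale (\<lambda>v. br y (d v))" by (rule linear_comp_fun[OF linear_br ld])
    have lyz: "Vector_Spaces.linear scale scale (\<lambda>v. br y (br z v))" by (rule linear_comp_fun[OF linear_br linear_br])
    have lzy: "Vector_Spaces.linear scale scale (\<lambda>v. br z (br y v))" by (rule linear_comp_fun[OF linear_br linear_br])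
    have "trace (\<lambda>v. br y (br (d z) v)) = trace (\<lambda>v. br y (d (br z v)) - br y (br z (d v)))"
      using derivation_D[OF d, of z] by (simp add: br.add[symmetric] br.diff[symmetric])
    also have "\<dots> = trace (\<lambda>v. br y (d (br z v))) - trace (\<lambda>v. br y (br z (d v)))"
      by (rule trace_diff[OF linear_comp_fun[OF lyd linear_br] linear_comp_fun[OF lyz ld]])
    also have "trace (\<lambda>v. br y (d (br z v))) = trace (\<lambda>v. d (br z (br y v)))"
      using trace_comp_commute[OF linear_br linear_comp_fun[OF ld linear_br], of y z] by simp
    also have "trace (\<lambda>v. br y (br z (d v))) = trace (\<lambda>v. d (br y (br z v)))"
      by (rule trace_comp_commute[OF lyz ld])
    also have "trace (\<lambda>v. d (br z (br y v))) - trace (\<lambda>v. d (br y (br z v))) = trace (\<lambda>v. d (br (br z y) v))"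
      using trace_diff[OF linear_comp_fun[OF ld lzy] linear_comp_fun[OF ld lyz]]
      by (simp add: ad_br d.diff)
    also have "\<dots> = 0" using trace_derivation_ad[OF d] S y by blast
    finally show ?thesis .
  qed
  then have "(\<Union>e\<in>D. range e) \<subseteq> {x. trace (\<lambda>v. br y (br x v)) = 0}" by auto
  then have "span (\<Union>e\<in>D. range e) \<subseteq> {x. trace (\<lambda>v. br y (br x v)) = 0}"
    by (rule span_minimal) (rule subspace_trace_ad[OF linear_br])
  then have "trace (\<lambda>v. br y (br x v)) = 0" using x S by auto
  then show ?thesis using trace_comp_commute[OF linear_br linear_br, of x y] by simp
qed

end

end

text \<open>For an additive \<open>\<psi>\<close>, let \<open>Y\<close> be the diagonal matrix with entries \<open>\<psi> (J i i)\<close>. Bracketing with \<open>Y\<close>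
  leaves the span \<open>W\<close> of \<open>ad P\<close> invariant, so \<open>tr ([ad a, ad b] Y) = tr (ad a [ad b, Y])\<close> is a value of the
  trace form on \<open>W\<close> and vanishes. As \<open>P = [P, P]\<close>, this gives \<open>tr (J Y) = 0\<close>.\<close>

lemma (in lie_algebra_rep) cartan_ad_nilpotent:
  assumes P: "bs P P = P"
    and killing: "\<And>x y. x \<in> P \<Longrightarrow> y \<in> P \<Longrightarrow> trace (\<lambda>v. br x (br y v)) = 0"
    and x: "x \<in> P"
    and J: "\<And>i j. \<rho> (br x) i j \<noteq> 0 \<Longrightarrow> i < m \<and> j < m \<and> i \<le> j \<and> \<rho> (br x) i i = \<rho> (br x) j j"
  shows "\<exists>N. \<forall>v. (br x ^^ N) v = 0"
proof -
  let ?J = "\<rho> (br x)"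
  define G where "G = (\<lambda>y. \<rho> (br y)) ` P"
  \<comment> \<open>The eigenvalues of \<open>ad J\<close> lie in \<open>'f\<close>, so the span is
    taken over \<open>'f\<close>, although \<open>P\<close> itself only has scalars from
    \<open>'k\<close>.\<close>
  define W where "W = mat_vs.span G"
  have subW: "mat_vs.subspace W" unfolding W_def by simp
  have W_induct: "Z \<in> W \<Longrightarrow> mat_vs.subspace {w. Q w} \<Longrightarrow> (\<And>y. y \<in> P \<Longrightarrow> Q (\<rho> (br y))) \<Longrightarrow> Q Z" for Q Z
    using mat_vs.span_minimal[of G "{w. Q w}"] unfolding W_def G_def by blast
  have support: "\<forall>i j. w i j \<noteq> 0 \<longrightarrow> i < m \<and> j < m" if "w \<in> W" for w
  proof (rule W_induct[OF that])
    show "mat_vs.subspace {w :: nat \<Rightarrow> nat \<Rightarrow> 'f. \<forall>i j. w i j \<noteq> 0 \<longrightarrow> i < m \<and> j < m}"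
      unfolding mat_vs.subspace_def by (auto simp: mat_scale_def) (metis add.right_neutral)+
  qed (use rep_support in blast)
  \<comment> \<open>On generators the bracket with \<open>ad x\<close> is \<open>ad [x, y]\<close>,
    and \<open>[x, y]\<close> lies in \<open>P\<close>.\<close>
  have ad_inv: "(\<lambda>i j. (\<Sum>k<m. ?J i k * w k j) - (\<Sum>k<m. w i k * ?J k j)) \<in> W" if "w \<in> W" for w
  proof (rule W_induct[OF that])
    let ?T = "\<lambda>w i j. (\<Sum>k<m. ?J i k * w k j) - (\<Sum>k<m. w i k * ?J k j)"
    have "?T 0 = 0" "?T (v + w) = ?T v + ?T w" "?T (mat_scale c w) = mat_scale c (?T w)" for v w c
      by (auto simp: fun_eq_iff mat_scale_def algebra_simps sum.distrib sum_distrib_left)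
    then show "mat_vs.subspace {w. ?T w \<in> W}"
      using subW unfolding mat_vs.subspace_def by auto
    fix y assume y: "y \<in> P"
    have "\<rho> (br (br x y)) = ?T (\<rho> (br y))"
      unfolding ad_br
      by (intro ext) (simp only: rep_diff[OF linear_comp_fun[OF linear_br linear_br] linear_comp_fun[OF linear_br linear_br]]
          rep_comp[OF linear_br linear_br])
    moreover have "br x y \<in> P" using br_mem_bs[OF x y] P by simp
    ultimately show "?T (\<rho> (br y)) \<in> W" unfolding W_def G_def by (metis image_eqI mat_vs.span_base)
  qed
  have subT: "mat_vs.subspace {w. (\<Sum>i<m. \<Sum>k<m. w i k * w' k i) = 0}" for w' :: "nat \<Rightarrow> nat \<Rightarrow> 'f"
    unfolding mat_vs.subspace_def
    by (auto simp: mat_scale_def algebra_simps sum.distrib simp flip: sum_distrib_left)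
  have trW1: "(\<Sum>i<m. \<Sum>k<m. w i k * \<rho> (br y) k i) = 0" if "w \<in> W" "y \<in> P" for w y
    by (rule W_induct[OF that(1)], rule subT)
      (simp add: killing that(2) flip: trace_comp[OF linear_br linear_br])
  have trW: "(\<Sum>i<m. \<Sum>k<m. w' i k * w k i) = 0" if "w \<in> W" "w' \<in> W" for w w'
  proof (rule W_induct[OF that(2)], rule subT)
    fix y assume "y \<in> P"
    have "(\<Sum>i<m. \<Sum>k<m. \<rho> (br y) i k * w k i) = (\<Sum>i<m. \<Sum>k<m. w i k * \<rho> (br y) k i)"
      by (subst sum.swap) (simp add: mult.commute)
    then show "(\<Sum>i<m. \<Sum>k<m. \<rho> (br y) i k * w k i) = 0" using trW1[OF that(1) \<open>y \<in> P\<close>] by simp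
  qed
  have diag: "?J i i = 0" if "i < m" for i
  proof (rule all_zero_of_rational_trace[of "\<lambda>i. ?J i i" m, OF _ that])
    fix \<phi> :: "'f \<Rightarrow> rat" assume \<phi>: "\<And>x y. \<phi> (x + y) = \<phi> x + \<phi> y"
    define \<psi> :: "'f \<Rightarrow> 'f" where "\<psi> t = of_rat (\<phi> t)" for t
    have "\<phi> (s - t) = \<phi> s - \<phi> t" for s t using \<phi>[of "s - t" t] by simp
    then have \<psi>: "\<psi> (s - t) = \<psi> s - \<psi> t" for s t by (simp add: \<psi>_def of_rat_diff)
    have "(\<Sum>i<m. \<rho> (br z) i i * \<psi> (?J i i)) = 0" if z: "z \<in> P" for z
    proof -
      let ?S = "{z. (\<Sum>i<m. \<rho> (br z) i i * \<psi> (?J i i)) = 0}"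
      have zero: "\<rho> (br 0) i j = 0" for i j
        using rep_diff[OF linear_zero_fun linear_zero_fun, of i j] by (simp add: br_zero_left[abs_def])
      have "bs P P \<subseteq> ?S"
      proof (rule bs_least)
        show "subspace ?S"
          unfolding subspace_def
          by (auto simp: zero ad_add ad_scale rep_add linear_br rep_scale distrib_right sum.distrib mult.assoc
              simp flip: sum_distrib_left)
        fix a b assume a: "a \<in> P" and b: "b \<in> P"
        let ?a = "\<rho> (br a)" and ?b = "\<rho> (br b)"
        \<comment> \<open>By additivity of \<open>\<psi>\<close> this matrix is the bracket of the
          diagonal matrix \<open>Y\<close> with \<open>ad b\<close>.\<close>
        have "(\<lambda>i j. \<psi> (?J i i - ?J j j) * ?b i j) \<in> W"
          by (rule block_triangular_ad_invariant[OF J subW _ ad_inv])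
            (use support b in \<open>auto simp: W_def G_def intro: mat_vs.span_base\<close>)
        moreover have "?a \<in> W" using a by (auto simp: W_def G_def intro: mat_vs.span_base)
        ultimately have 0: "(\<Sum>i<m. \<Sum>k<m. ?a i k * (\<psi> (?J k k - ?J i i) * ?b k i)) = 0"
          by (rule trW)
        have "(\<Sum>i<m. \<rho> (br (br a b)) i i * \<psi> (?J i i)) =
          (\<Sum>i<m. \<Sum>k<m. ?a i k * ?b k i * \<psi> (?J i i)) - (\<Sum>i<m. \<Sum>k<m. ?b i k * ?a k i * \<psi> (?J i i))"
          unfolding ad_br
            rep_diff[OF linear_comp_fun[OF linear_br linear_br] linear_comp_fun[OF linear_br linear_br]]
            rep_comp[OF linear_br linear_br]
          by (simp add: left_diff_distrib sum_subtractf sum_distrib_right)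
        also have "(\<Sum>i<m. \<Sum>k<m. ?b i k * ?a k i * \<psi> (?J i i)) = (\<Sum>i<m. \<Sum>k<m. ?a i k * ?b k i * \<psi> (?J k k))"
          by (subst sum.swap) (simp add: mult_ac)
        also have "(\<Sum>i<m. \<Sum>k<m. ?a i k * ?b k i * \<psi> (?J i i)) - (\<Sum>i<m. \<Sum>k<m. ?a i k * ?b k i * \<psi> (?J k k))
            = - (\<Sum>i<m. \<Sum>k<m. ?a i k * (\<psi> (?J k k - ?J i i) * ?b k i))"
          by (simp add: \<psi> algebra_simps sum_subtractf)
        finally show "br a b \<in> ?S" using 0 by simp
      qed
      then show ?thesis using z P by auto
    qed
    from this[OF x] show "(\<Sum>i<m. ?J i i * of_rat (\<phi> (?J i i))) = 0" unfolding \<psi>_def .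
  qed
  \<comment> \<open>With its diagonal zero, the upper triangular matrix of \<open>ad x\<close> is
    strictly triangular.\<close>
  show ?thesis
    by (rule strictly_triangular_nilpotent[OF linear_br]) (metis J diag le_neq_implies_less)
qed

theorem theorem2:
  fixes scale :: "'k::field_char_0 \<Rightarrow> 'a::ab_group_add \<Rightarrow> 'a"
    and br :: "'a \<Rightarrow> 'a \<Rightarrow> 'a"
    and D :: "('a \<Rightarrow> 'a) set"
    and n :: nat
  assumes "lie_algebra scale br"
    and "\<exists>B. finite_dimensional_vector_space scale B"
    and "D \<subseteq> derivations scale br"
    and "lie_subalgebra (fun_scale scale) commutator D"
    and "lie_abelian commutator D"
    and "n > 1"
    and "lower_central scale br n \<subseteq> sum_of_images D"
  shows "lie_solvable scale br"
proof -
  obtain Basis where "finite_dimensional_vector_space scale Basis" using assms(2) by blast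
  then interpret fd_lie_algebra scale br Basis using assms(1) by (simp add: fd_lie_algebra_def)
  have comm: "d (e x) = e (d x)" if "d \<in> D" "e \<in> D" for d e x
    using assms(5) that unfolding lie_abelian_def commutator_def by (auto simp: fun_eq_iff)
  have sub: "lower_central scale br n \<subseteq> span (\<Union>e\<in>D. range e)"
    using assms(7) sum_of_images_eq_span[OF assms(4,3)] by simp
  obtain k where k: "subspace (derived_series scale br k)"
    "bs (derived_series scale br k) (derived_series scale br k) = derived_series scale br k"
    by (rule derived_series_stabilizes)
  define P where "P = derived_series scale br k"
  note P = k[folded P_def]
  have "\<exists>N. \<forall>v. (br x ^^ N) v = 0" if x: "x \<in> P" for x
  proof -
    \<comment> \<open>The basis is adapted to \<open>ad x\<close>, so each \<open>x\<close> gets its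
      own representation, and the Killing form is shown to vanish in that one.\<close>
    obtain m and \<rho> :: "('a \<Rightarrow> 'a) \<Rightarrow> nat \<Rightarrow> nat \<Rightarrow> 'k alg_closure" where rep: "matrix_rep scale m \<rho> to_ac"
      and J: "\<And>i j. \<rho> (br x) i j \<noteq> 0 \<Longrightarrow> i < m \<and> j < m \<and> i \<le> j \<and> \<rho> (br x) i i = \<rho> (br x) j j"
      using exists_block_triangular_matrix_rep[OF linear_br] by blast
    interpret lie_algebra_rep scale br m \<rho> to_ac
      using rep assms(1) by (simp add: lie_algebra_rep_def)
    have "trace (\<lambda>v. br y (br z v)) = 0" if "y \<in> P" "z \<in> P" for y z
      using perfect_subset_lower_central[OF P(2), of n] that
      by (intro killing_form_vanishes[OF assms(3) _ sub]) (auto intro: comm lower_central_ideal)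
    then show ?thesis using cartan_ad_nilpotent[OF P(2) _ x J] by blast
  qed
  then have "P = {0}" using perfect_ad_nilpotent_trivial[OF P] by blast
  then show ?thesis unfolding lie_solvable_def P_def by blast
qed

end
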